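(* Let $C$ be a satisfiable $\mathcal{ALC}\iota$ concept. Then there exists a model $\mathcal{I}$ of $C$ (an interpretation with $C^{\mathcal{I}}\neq\emptyset$) whose domain has size at most exponential in $|C|$.
   Context: $\mathcal{ALC}\iota$ concepts: $C ::= A \mid \neg C \mid (C\sqcap C) \mid \exists r.C \mid \{\iota C\} \mid \iota C.C$ ($A$ atomic concept, $r$ role). Semantics over interpretations $\mathcal{I}=(\Delta^{\mathcal{I}},\cdot^{\mathcal{I}})$: standard for $\neg,\sqcap,\exists r$; $(\{\iota C\})^{\mathcal{I}}=\{d\}$ if $C^{\mathcal{I}}=\{d\}$, else $\emptyset$; $(\iota C.D)^{\mathcal{I}}=\Delta^{\mathcal{I}}$ if $C^{\mathcal{I}}=\{d\}\subseteq D^{\mathcal{I}}$ for some $d$, else $\emptyset$. $|C|$ is the number of symbols in $C$ excluding parentheses. *)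

theory Defs
  imports Main
begin

datatype ('c, 'r) concept =
    Atom 'c
  | Neg "('c, 'r) concept"
  | Conj "('c, 'r) concept" "('c, 'r) concept"
  | Ex 'r "('c, 'r) concept"
  | Nom "('c, 'r) concept" \<comment> \<open>the concept \<open>{\<iota>C}\<close>\<close>
  | Desc "('c, 'r) concept" "('c, 'r) concept" \<comment> \<open>the concept \<open>\<iota>C.D\<close>\<close>

text \<open>
  The number of symbols without parentheses. The quantifier, the role name, the dot, the iota
  and each of the two braces of \<open>{\<iota>C}\<close> count as one symbol.
\<close>

primrec csize :: "('c, 'r) concept \<Rightarrow> nat" where
  "csize (Atom A) = 1"
| "csize (Neg C) = 1 + csize C"
| "csize (Conj C D) = 1 + csize C + csize D"
| "csize (Ex r C) = 3 + csize C"
| "csize (Nom C) = 3 + csize C"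
| "csize (Desc C D) = 2 + csize C + csize D"

record ('d, 'c, 'r) interp =
  dom :: "'d set"
  cint :: "'c \<Rightarrow> 'd set"
  rint :: "'r \<Rightarrow> ('d \<times> 'd) set"

definition interpretation_wf :: "('d, 'c, 'r) interp \<Rightarrow> bool" where
  "interpretation_wf I \<longleftrightarrow>
     dom I \<noteq> {} \<and> (\<forall>A. cint I A \<subseteq> dom I) \<and> (\<forall>r. rint I r \<subseteq> dom I \<times> dom I)"

primrec ext :: "('d, 'c, 'r) interp \<Rightarrow> ('c, 'r) concept \<Rightarrow> 'd set" where
  "ext I (Atom A) = cint I A"
| "ext I (Neg C) = dom I - ext I C"
| "ext I (Conj C D) = ext I C \<inter> ext I D"
| "ext I (Ex r C) = {d \<in> dom I. \<exists>e. (d, e) \<in> rint I r \<and> e \<in> ext I C}"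
| "ext I (Nom C) = (if \<exists>d. ext I C = {d} then ext I C else {})"
| "ext I (Desc C D) = (if \<exists>d. ext I C = {d} \<and> {d} \<subseteq> ext I D then dom I else {})"

definition is_model :: "('d, 'c, 'r) interp \<Rightarrow> ('c, 'r) concept \<Rightarrow> bool" where
  "is_model I C \<longleftrightarrow> interpretation_wf I \<and> ext I C \<noteq> {}"

end

theory Submission
  imports Defs
begin

text \<open>
  The domain of a model is cut down to at most two representatives of each type, where the type of
  an element is the set of subconcepts of \<open>C\<close> that it satisfies. Plain filtration, with one element
  per type, could turn a non-singleton extension into a singleton and so change the value of a
  definite description; two elements for each type that is realised at least twice prevent this.
\<close>

section \<open>Subconcepts and their number\<close>

primrec subconcepts :: "('c, 'r) concept \<Rightarrow> ('c, 'r) concept set" where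
  "subconcepts (Atom A) = {Atom A}"
| "subconcepts (Neg C) = insert (Neg C) (subconcepts C)"
| "subconcepts (Conj C D) = insert (Conj C D) (subconcepts C \<union> subconcepts D)"
| "subconcepts (Ex r C) = insert (Ex r C) (subconcepts C)"
| "subconcepts (Nom C) = insert (Nom C) (subconcepts C)"
| "subconcepts (Desc C D) = insert (Desc C D) (subconcepts C \<union> subconcepts D)"

lemma finite_subconcepts: "finite (subconcepts C)"
  by (induction C) auto

lemma self_in_subconcepts: "C \<in> subconcepts C"
  by (cases C) auto

lemma subconcepts_trans: "D \<in> subconcepts C \<Longrightarrow> subconcepts D \<subseteq> subconcepts C"
  by (induction C) auto

text \<open>Each constructor contributes at least one symbol but at most one new subconcept;
  subconcepts shared by two arguments only lower the count.\<close>

lemma card_subconcepts_le: "card (subconcepts C) \<le> csize C"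
proof (induction C)
  case (Conj C D)
  have "card (subconcepts (Conj C D)) \<le> Suc (card (subconcepts C \<union> subconcepts D))"
    by (simp add: card_insert_le_m1)
  also have "\<dots> \<le> Suc (card (subconcepts C) + card (subconcepts D))"
    by (simp add: card_Un_le)
  finally show ?case using Conj by simp
next
  case (Desc C D)
  have "card (subconcepts (Desc C D)) \<le> Suc (card (subconcepts C \<union> subconcepts D))"
    by (simp add: card_insert_le_m1)
  also have "\<dots> \<le> Suc (card (subconcepts C) + card (subconcepts D))"
    by (simp add: card_Un_le)
  finally show ?case using Desc by simp
qed (auto simp: card_insert_if finite_subconcepts)

lemma csize_pos: "0 < csize C"
  by (cases C) auto

lemma ext_subset_dom: "interpretation_wf I \<Longrightarrow> ext I C \<subseteq> dom I"
  by (induction C) (auto simp: interpretation_wf_def)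

section \<open>Copies of interpretations along injections\<close>

definition image_interp :: "('d \<Rightarrow> 'e) \<Rightarrow> ('d, 'c, 'r) interp \<Rightarrow> ('e, 'c, 'r) interp" where
  "image_interp f I = \<lparr>dom = f ` dom I, cint = (\<lambda>A. f ` cint I A),
     rint = (\<lambda>r. map_prod f f ` rint I r)\<rparr>"

lemma interpretation_wf_image_interp:
  "interpretation_wf I \<Longrightarrow> interpretation_wf (image_interp f I)"
  unfolding interpretation_wf_def image_interp_def by fastforce

text \<open>An injection on the domain is an isomorphism onto the image. This serves to move a
  finite model from an arbitrary element type to \<open>nat\<close>. Injectivity makes images
  commute with complement and intersection and prevents larger extensions from collapsing to
  singletons.\<close>

lemma ext_image_interp:
  assumes wf: "interpretation_wf I" and inj: "inj_on f (dom I)"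
  shows "ext (image_interp f I) C = f ` ext I C"
proof -
  \<comment> \<open>The parameter \<open>P\<close> lets one fact serve both iota constructors: it is
    trivial for \<open>Nom\<close> and expresses membership in the image of the second argument for
    \<open>Desc\<close>.\<close>
  have singleton: "(\<exists>d. f ` ext I D = {d} \<and> P d) \<longleftrightarrow> (\<exists>d. ext I D = {d} \<and> P (f d))" for D P
  proof
    assume "\<exists>d. f ` ext I D = {d} \<and> P d"
    then obtain d where d: "f ` ext I D = {d}" "P d" by blast
    then obtain x where x: "x \<in> ext I D" "f x = d" by blast
    have "y = x" if "y \<in> ext I D" for y
    proof -
      have "f y = f x" using that d(1) x by blast
      then show ?thesis using inj ext_subset_dom[OF wf, of D] that x(1) by (meson inj_onD subsetD)
    qed
    then show "\<exists>d. ext I D = {d} \<and> P (f d)" using x d(2) by blast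
  qed auto
  have mem: "f x \<in> f ` ext I D \<longleftrightarrow> x \<in> ext I D" if "x \<in> dom I" for x D
    using inj ext_subset_dom[OF wf, of D] that by (simp add: inj_on_image_mem_iff)
  show ?thesis
  proof (induction C)
    case (Atom A)
    then show ?case by (simp add: image_interp_def)
  next
    case (Neg C)
    then show ?case
      using inj_on_image_set_diff[OF inj, of "dom I" "ext I C"] ext_subset_dom[OF wf, of C]
      by (auto simp: image_interp_def)
  next
    case (Conj C D)
    then show ?case
      using inj_on_image_Int[OF inj ext_subset_dom[OF wf] ext_subset_dom[OF wf], of C D] by simp
  next
    case (Ex r C)
    have role: "rint I r \<subseteq> dom I \<times> dom I"
      using wf by (simp add: interpretation_wf_def)
    show ?case
    proof (intro equalityI subsetI)
      fix y assume "y \<in> ext (image_interp f I) (Ex r C)"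
      then obtain z where z: "(y, z) \<in> map_prod f f ` rint I r" "z \<in> f ` ext I C"
        unfolding ext.simps Ex by (simp add: image_interp_def) metis
      then obtain a b where ab: "(a, b) \<in> rint I r" "y = f a" "z = f b"
        by auto
      then have dom: "a \<in> dom I" "b \<in> dom I" using role by auto
      have "b \<in> ext I C" using mem[OF dom(2), of C] z(2) ab(3) by simp
      then have "a \<in> ext I (Ex r C)" using ab(1) dom(1) by auto
      then show "y \<in> f ` ext I (Ex r C)" using ab by blast
    next
      fix y assume "y \<in> f ` ext I (Ex r C)"
      then obtain a b where "a \<in> dom I" "(a, b) \<in> rint I r" "y = f a" "b \<in> ext I C"
        by auto
      then have "y \<in> f ` dom I" "(y, f b) \<in> map_prod f f ` rint I r" "f b \<in> f ` ext I C"
        by force+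
      then show "y \<in> ext (image_interp f I) (Ex r C)"
        unfolding ext.simps Ex by (simp add: image_interp_def) metis
    qed
  next
    case (Nom C)
    then show ?case using singleton[of C "\<lambda>_. True"] by simp
  next
    case (Desc C D)
    have "ext I C = {d} \<and> f d \<in> f ` ext I D \<longleftrightarrow> ext I C = {d} \<and> d \<in> ext I D" for d
      using mem[of d D] ext_subset_dom[OF wf, of C] by blast
    then have "(\<exists>d. f ` ext I C = {d} \<and> {d} \<subseteq> f ` ext I D) \<longleftrightarrow>
        (\<exists>d. ext I C = {d} \<and> {d} \<subseteq> ext I D)"
      using singleton[of C "\<lambda>d. d \<in> f ` ext I D"] by simp
    moreover have "dom (image_interp f I) = f ` dom I" by (simp add: image_interp_def)
    ultimately show ?case by (simp only: ext.simps Desc if_distrib[of "image f"] image_empty)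
  qed
qed

section \<open>Choice of representatives\<close>

lemma ex_two_representatives:
  fixes f :: "'a \<Rightarrow> 'b"
  assumes fin: "finite (f ` X)"
  obtains W where "W \<subseteq> X" "finite W" "card W \<le> 2 * card (f ` X)"
    "\<forall>x\<in>X. \<exists>w\<in>W. f w = f x"
    "\<forall>x\<in>X. \<forall>y\<in>X. x \<noteq> y \<longrightarrow> (\<exists>v\<in>W. \<exists>w\<in>W. v \<noteq> w \<and> f v = f x \<and> f w = f y)"
proof -
  define a where "a t = (SOME x. x \<in> X \<and> f x = t)" for t
  define b where "b t = (SOME x. x \<in> X \<and> f x = t \<and> x \<noteq> a t)" for t
  \<comment> \<open>When the value \<open>t\<close> is attained only once, nothing satisfies the
    condition on \<open>b t\<close>, so \<open>SOME\<close> yields an arbitrary element;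
    intersecting with \<open>X\<close> removes it if it lies outside \<open>X\<close>.\<close>
  define W where "W = X \<inter> (a ` f ` X \<union> b ` f ` X)"
  have a: "a (f x) \<in> X \<and> f (a (f x)) = f x" if "x \<in> X" for x
    unfolding a_def by (rule someI[of _ x]) (simp add: that)
  have b: "b (f x) \<in> X \<and> f (b (f x)) = f x \<and> b (f x) \<noteq> a (f x)"
    if "x \<in> X" "x \<noteq> a (f x)" for x
    unfolding b_def by (rule someI[of _ x]) (use that in simp)
  have fin': "finite (a ` f ` X \<union> b ` f ` X)" using fin by simp
  have "card W \<le> card (a ` f ` X \<union> b ` f ` X)"
    unfolding W_def by (rule card_mono[OF fin']) blast
  also have "\<dots> \<le> card (a ` f ` X) + card (b ` f ` X)" by (rule card_Un_le)
  also have "\<dots> \<le> 2 * card (f ` X)"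
    using card_image_le[OF fin, of a] card_image_le[OF fin, of b] by simp
  finally have card: "card W \<le> 2 * card (f ` X)" .
  have aW: "a (f x) \<in> W" if "x \<in> X" for x
    using a[OF that] that unfolding W_def by blast
  have bW: "b (f x) \<in> W" if "x \<in> X" "x \<noteq> a (f x)" for x
    using b[OF that] that unfolding W_def by blast
  show thesis
  proof (rule that[of W])
    show "W \<subseteq> X" "finite W" using fin' by (auto simp: W_def)
    show "card W \<le> 2 * card (f ` X)" by (rule card)
    show "\<forall>x\<in>X. \<exists>w\<in>W. f w = f x"
      using a aW by blast
    have "\<exists>v\<in>W. \<exists>w\<in>W. v \<noteq> w \<and> f v = f x \<and> f w = f y"
      if xy: "x \<in> X" "y \<in> X" "x \<noteq> y" for x y
    proof (cases "f x = f y")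
      case False
      \<comment> \<open>First representatives of different values are automatically
        different.\<close>
      then show ?thesis using a[of x] a[of y] aW[of x] aW[of y] xy by metis
    next
      case True
      \<comment> \<open>Two distinct elements with the same value cannot both be its first
        representative, so the second one is a genuine choice.\<close>
      then have "x \<noteq> a (f x) \<or> y \<noteq> a (f y)" using xy by auto
      then have "a (f x) \<noteq> b (f x) \<and> b (f x) \<in> W \<and> f (b (f x)) = f y"
        using b[of x] b[of y] bW[of x] bW[of y] xy True by auto
      then show ?thesis using a[of x] aW[of x] xy by blast
    qed
    then show "\<forall>x\<in>X. \<forall>y\<in>X. x \<noteq> y \<longrightarrow>
        (\<exists>v\<in>W. \<exists>w\<in>W. v \<noteq> w \<and> f v = f x \<and> f w = f y)"
      by blast
  qed
qed

section \<open>Types and filtration\<close>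

definition concept_type ::
    "('d, 'c, 'r) interp \<Rightarrow> ('c, 'r) concept \<Rightarrow> 'd \<Rightarrow> ('c, 'r) concept set" where
  "concept_type I C d = {D \<in> subconcepts C. d \<in> ext I D}"

lemma concept_type_eqD:
  "concept_type I C d = concept_type I C e \<Longrightarrow> D \<in> subconcepts C \<Longrightarrow>
     d \<in> ext I D \<longleftrightarrow> e \<in> ext I D"
  unfolding concept_type_def by blast

text \<open>The elements of \<open>W\<close> are kept as they are, so only the target of an edge is
  read up to type: an edge to a discarded element is redirected to all elements of \<open>W\<close>
  of the same type.\<close>

definition filtrate ::
    "('d, 'c, 'r) interp \<Rightarrow> ('c, 'r) concept \<Rightarrow> 'd set \<Rightarrow> ('d, 'c, 'r) interp" where
  "filtrate I C W = \<lparr>dom = W, cint = (\<lambda>A. cint I A \<inter> W),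
     rint = (\<lambda>r. {(d, e) \<in> W \<times> W.
       \<exists>e'. (d, e') \<in> rint I r \<and> concept_type I C e' = concept_type I C e})\<rparr>"

text \<open>Membership in a subconcept depends only on the type, so \<open>one\<close> provides the
  successors that \<open>Ex\<close> needs. Together with \<open>two\<close> it ensures that
  \<open>W\<close> sees exactly the singleton extensions as singletons, which settles
  \<open>Nom\<close> and \<open>Desc\<close>.\<close>

lemma ext_filtrate:
  fixes I :: "('d, 'c, 'r) interp"
  assumes wf: "interpretation_wf I" and sub: "W \<subseteq> dom I"
    and one: "\<forall>x\<in>dom I. \<exists>w\<in>W. concept_type I C w = concept_type I C x"
    and two: "\<forall>x\<in>dom I. \<forall>y\<in>dom I. x \<noteq> y \<longrightarrow>
      (\<exists>v\<in>W. \<exists>w\<in>W. v \<noteq> w \<and> concept_type I C v = concept_type I C x \<and>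
        concept_type I C w = concept_type I C y)"
  shows "D \<in> subconcepts C \<Longrightarrow> ext (filtrate I C W) D = ext I D \<inter> W"
proof -
  have singleton: "ext I D \<inter> W = {d} \<longleftrightarrow> ext I D = {d}" if D: "D \<in> subconcepts C" for D d
  proof
    assume d: "ext I D = {d}"
    then have "d \<in> dom I" using ext_subset_dom[OF wf, of D] by blast
    then obtain w where w: "w \<in> W" "concept_type I C w = concept_type I C d" using one by blast
    \<comment> \<open>The only instance of \<open>D\<close> shares its type with no other element,
      so it is its own representative and survives in \<open>W\<close>.\<close>
    then have "w = d" using concept_type_eqD[OF w(2) D] d by simp
    then show "ext I D \<inter> W = {d}" using w(1) d by simp
  next
    assume d: "ext I D \<inter> W = {d}"
    \<comment> \<open>A second instance of \<open>D\<close> would leave two distinct instances in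
      \<open>W\<close>, even if it has the same type as \<open>d\<close>.\<close>
    have "x = d" if x: "x \<in> ext I D" for x
    proof (rule ccontr)
      assume "x \<noteq> d"
      moreover have "x \<in> dom I" "d \<in> dom I" using x d ext_subset_dom[OF wf, of D] by blast+
      ultimately obtain v w where vw: "v \<in> W" "w \<in> W" "v \<noteq> w"
        "concept_type I C v = concept_type I C x" "concept_type I C w = concept_type I C d"
        using two by blast
      then have "v \<in> ext I D" "w \<in> ext I D"
        using concept_type_eqD[OF vw(4) D] concept_type_eqD[OF vw(5) D] x d by blast+
      then have "v \<in> {d}" "w \<in> {d}" using vw(1,2) unfolding d[symmetric] by blast+
      then show False using vw(3) by simp
    qed
    then show "ext I D = {d}" using d by blast
  qed
  show "D \<in> subconcepts C \<Longrightarrow> ext (filtrate I C W) D = ext I D \<inter> W"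
  proof (induction D)
    case (Atom A)
    then show ?case by (simp add: filtrate_def)
  next
    case (Neg D)
    then have "D \<in> subconcepts C" using subconcepts_trans self_in_subconcepts by fastforce
    then show ?case using Neg sub by (auto simp: filtrate_def)
  next
    case (Conj D E)
    then have "D \<in> subconcepts C" "E \<in> subconcepts C"
      using subconcepts_trans[OF Conj.prems] self_in_subconcepts[of D] self_in_subconcepts[of E]
      by auto
    then show ?case using Conj by auto
  next
    case (Ex r D)
    then have D: "D \<in> subconcepts C" using subconcepts_trans self_in_subconcepts by fastforce
    have role: "rint I r \<subseteq> dom I \<times> dom I"
      using wf by (simp add: interpretation_wf_def)
    show ?case
    proof (intro equalityI subsetI)
      fix d assume "d \<in> ext (filtrate I C W) (Ex r D)"
      then obtain e e' where e: "d \<in> W" "e \<in> ext I D" "(d, e') \<in> rint I r"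
        "concept_type I C e' = concept_type I C e"
        using Ex.IH[OF D] by (auto simp: filtrate_def)
      then show "d \<in> ext I (Ex r D) \<inter> W" using concept_type_eqD[OF e(4) D] sub by auto
    next
      fix d assume "d \<in> ext I (Ex r D) \<inter> W"
      then obtain e' where e': "d \<in> W" "(d, e') \<in> rint I r" "e' \<in> ext I D" by auto
      \<comment> \<open>The successor \<open>e'\<close> may be missing from \<open>W\<close>; its
        representative \<open>e\<close> is a successor of \<open>d\<close> in the filtrate, whether
        or not it was one in \<open>I\<close>.\<close>
      then obtain e where e: "e \<in> W" "concept_type I C e = concept_type I C e'"
        using one role by blast
      then have "e \<in> ext I D \<inter> W" using concept_type_eqD[OF e(2) D] e' by blast
      moreover have "(d, e) \<in> rint (filtrate I C W) r"
        using e e' by (auto simp: filtrate_def)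
      ultimately show "d \<in> ext (filtrate I C W) (Ex r D)"
        using Ex.IH[OF D] e' by (auto simp: filtrate_def)
    qed
  next
    case (Nom D)
    then have "D \<in> subconcepts C" using subconcepts_trans self_in_subconcepts by fastforce
    then show ?case using Nom singleton by auto
  next
    case (Desc D E)
    then have DE: "D \<in> subconcepts C" "E \<in> subconcepts C"
      using subconcepts_trans[OF Desc.prems] self_in_subconcepts[of D] self_in_subconcepts[of E]
      by auto
    \<comment> \<open>Either side forces \<open>d\<close> into \<open>W\<close>, so restricting
      \<open>ext I E\<close> to \<open>W\<close> cannot falsify the inclusion.\<close>
    have "ext I D \<inter> W = {d} \<and> {d} \<subseteq> ext I E \<inter> W \<longleftrightarrow> ext I D = {d} \<and> {d} \<subseteq> ext I E" for d
      using singleton[OF DE(1), of d] by blast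
    moreover have "dom (filtrate I C W) = dom I \<inter> W"
      using sub by (auto simp: filtrate_def)
    ultimately show ?case using Desc DE by auto
  qed
qed

section \<open>The exponential bound\<close>

text \<open>Types are sets of subconcepts, hence at most \<open>2 ^ csize C\<close> many; the second
  representative of each type accounts for the \<open>Suc\<close> in the exponent.\<close>

lemma small_model:
  fixes I :: "('d, 'c, 'r) interp"
  assumes "is_model I C"
  obtains J :: "('d, 'c, 'r) interp"
  where "is_model J C" "finite (dom J)" "card (dom J) \<le> 2 ^ Suc (csize C)"
proof -
  have wf: "interpretation_wf I" using assms by (simp add: is_model_def)
  have types: "concept_type I C ` dom I \<subseteq> Pow (subconcepts C)"
    by (auto simp: concept_type_def)
  have finP: "finite (Pow (subconcepts C))" by (simp add: finite_subconcepts)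
  obtain W where W: "W \<subseteq> dom I" "finite W" "card W \<le> 2 * card (concept_type I C ` dom I)"
    and one: "\<forall>x\<in>dom I. \<exists>w\<in>W. concept_type I C w = concept_type I C x"
    and two: "\<forall>x\<in>dom I. \<forall>y\<in>dom I. x \<noteq> y \<longrightarrow>
      (\<exists>v\<in>W. \<exists>w\<in>W. v \<noteq> w \<and> concept_type I C v = concept_type I C x \<and>
        concept_type I C w = concept_type I C y)"
    by (rule ex_two_representatives[OF finite_subset[OF types finP]])
  have "card (concept_type I C ` dom I) \<le> 2 ^ card (subconcepts C)"
    using card_mono[OF finP types] by (simp add: card_Pow finite_subconcepts)
  also have "\<dots> \<le> 2 ^ csize C"
    by (rule power_increasing) (auto simp: card_subconcepts_le)
  finally have card: "card W \<le> 2 ^ Suc (csize C)" using W(3) by simp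
  have ext: "ext (filtrate I C W) C = ext I C \<inter> W"
    by (rule ext_filtrate[OF wf W(1) one two self_in_subconcepts])
  obtain x where x: "x \<in> ext I C" using assms by (auto simp: is_model_def)
  then obtain w where w: "w \<in> W" "concept_type I C w = concept_type I C x"
    using one ext_subset_dom[OF wf, of C] by blast
  \<comment> \<open>\<open>C\<close> is one of its own subconcepts, so the representative of an
    instance of \<open>C\<close> is again an instance.\<close>
  then have "w \<in> ext I C" using concept_type_eqD[OF w(2) self_in_subconcepts] x by blast
  then have "is_model (filtrate I C W) C"
    using w(1) ext unfolding is_model_def interpretation_wf_def by (auto simp: filtrate_def)
  then show thesis using that[of "filtrate I C W"] W(2) card by (simp add: filtrate_def)
qed

theorem theorem9:
  "\<exists>k::nat. \<forall>C :: ('c, 'r) concept.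
     (\<exists>I :: ('d, 'c, 'r) interp. is_model I C) \<longrightarrow>
     (\<exists>J :: (nat, 'c, 'r) interp.
        is_model J C \<and> finite (dom J) \<and> card (dom J) \<le> 2 ^ (k * csize C))"
\<comment> \<open>The constant 2 is uniform in \<open>C\<close>: \<open>Suc n \<le> 2 * n\<close>
  holds for every positive \<open>n\<close>, and \<open>csize C\<close> is positive.\<close>
proof (intro exI[of _ 2] allI impI)
  fix C :: "('c, 'r) concept"
  assume "\<exists>I :: ('d, 'c, 'r) interp. is_model I C"
  then obtain I :: "('d, 'c, 'r) interp" where "is_model I C" by blast
  then obtain J :: "('d, 'c, 'r) interp"
    where J: "is_model J C" "finite (dom J)" "card (dom J) \<le> 2 ^ Suc (csize C)"
    by (rule small_model)
  obtain f :: "'d \<Rightarrow> nat" where f: "inj_on f (dom J)"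
    using finite_imp_inj_to_nat_seg[OF J(2)] by blast
  have "(2::nat) ^ Suc (csize C) \<le> 2 ^ (2 * csize C)"
    using csize_pos[of C] by (intro power_increasing) auto
  then have "card (dom (image_interp f J)) \<le> 2 ^ (2 * csize C)"
    using J(3) card_image[OF f] by (simp add: image_interp_def)
  moreover have "is_model (image_interp f J) C"
    using J(1) ext_image_interp[OF _ f, of C] interpretation_wf_image_interp[of J f]
    by (simp add: is_model_def)
  ultimately show "\<exists>J :: (nat, 'c, 'r) interp.
      is_model J C \<and> finite (dom J) \<and> card (dom J) \<le> 2 ^ (2 * csize C)"
    using J(2) by (intro exI[of _ "image_interp f J"]) (simp add: image_interp_def)
qed

end
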